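(* Let $m\ge 1$, $p\ge 2$, and let $a_1,\dots,a_p$ be nonnegative integers with $a_i\le 10^m-1$ for each $i$. Starting from the empty yupana with $m$ rows, load $a_1,\dots,a_p$ with positive tokens, each on top of those already loaded, and then execute any finite sequence of table movements, in any order, ending in a state that is simple. Then the number shown by this final simple state equals $a_1+a_2+\cdots+a_p$.
   Context: **Board and states.** A yupana with $m$ rows is the board whose set of squares is $C=\{5,3,2,1\}\times\{0,1,\dots,m-1\}$; the square $(b,r)$ has weight $b$ and lies in row $r$. There are two colors of tokens, positive and negative. A state assigns to each square $(b,r)$ a number $N^+_{b,r}\in\mathbb{Z}_{\ge 0}$ of positive tokens and a number $N^-_{b,r}\in\mathbb{Z}_{\ge 0}$ of negative tokens. The effective value of a square is $E_{b,r}=(N^+_{b,r}-N^-_{b,r})\,b\,10^r$, and the value of the yupana is $\sum_{(b,r)\in C}E_{b,r}$. **Representation of digits.** A decimal digit is represented in a row by placing one token on each of the following squares of that row (listed by weight) and none on the others: $0$: none; $1$: $\{1\}$; $2$: $\{2\}$; $3$: $\{3\}$; $4$: $\{3,1\}$; $5$: $\{5\}$; $6$: $\{5,1\}$; $7$: $\{5,2\}$; $8$: $\{5,3\}$; $9$: $\{5,3,1\}$. **Loading.** Loading a number $a$ with $0\le a\le 10^m-1$ and decimal digits $d_{m-1}\cdots d_1d_0$, with tokens of a given color, means adding to the current state, for each $r$, tokens of that color representing the digit $d_r$ in row $r$. **Simple state.** A state is simple if all its tokens have a single color and each row $r$ represents some digit $d_r\in\{0,\dots,9\}$, meaning that row $r$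 has exactly one token on each square whose weight belongs to the set $S(d_r)$ and no token on its other squares, where $S(0)=\emptyset$, $S(1)=\{1\}$, $S(2)=\{2\}$, $S(3)=\{3\}$, $S(4)=\{3,1\}$, $S(5)=\{5\}$, $S(6)=\{5,1\}$, $S(7)=\{5,2\}$, $S(8)=\{5,3\}$, $S(9)=\{5,3,1\}$. The number shown by it is $\sum_r d_r10^r$ if the tokens are positive (or there are none), and $-\sum_r d_r10^r$ if they are negative. **Table movements.** Each movement below is available for every integer $k\ge1$ and row $r$ for which the tokens to be removed are present and all squares mentioned exist. Except for Chinkay, all tokens removed and placed in one movement have the same color (either one). Write $c\,[b]_r$ for $c$ tokens on square $(b,r)$; $X\to Y$ means remove $X$ and place $Y$. - Reducing: $2k[2]_r\to k[1]_r+k[3]_r$ (Iskay); $2k[3]_r\to k[1]_r+k[5]_r$ (Kimsa); $2k[5]_r\to k[1]_{r+1}$ (Pisqa); $2k[1]_r\to k[2]_r$, $3k[1]_r\to k[3]_r$, $5k[1]_r\to k[5]_r$ (Kikin); $k[1]_r+k[2]_r\to k[3]_r$, $k[2]_r+k[3]_r\to k[5]_r$ (Pichana). - Expansion: $k[5]_r\to k[3]_r+k[2]_r$; $k[3]_r\to k[2]_r+k[1]_r$; $k[2]_r\to 2k[1]_r$; $k[1]_{r+1}\to 2k[5]_r$; $k[1]_{r+1}\to k[5]_r+k[3]_r+k[2]_r$; $k[1]_{r+1}\to 2k[3]_r+2k[2]_r$; $k[1]_{r+1}\to k[3]_r+2k[2]_r+3k[1]_r$. - Composite: for $b\in\{5,3,2,1\}$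 and $n\ge1$, $10^n[b]_r\to 1[b]_{r+n}$ (Chunka, etc.); $2k[2]_r+2k[3]_r\to k[1]_{r+1}$ (Sonqo); $k[5]_r+k[3]_r+k[2]_r\to k[1]_{r+1}$ (Hatun Pichana); $2k[3]_r+k[2]_r+2k[1]_r\to k[1]_{r+1}$ (Paña Chaska); $k[3]_r+2k[2]_r+3k[1]_r\to k[1]_{r+1}$ (Huq-Iskay-Kimsa); $3k[3]_r+k[1]_r\to k[1]_{r+1}$ (K'usillu). - Chinkay: remove $k$ positive and $k$ negative tokens from one square. *)

theory Defs
  imports Main "HOL-Library.Multiset"
begin

datatype color = Positive | Negative

text \<open>The pair \<open>(b, r)\<close> is the square of weight \<open>b\<close> in row \<open>r\<close>.\<close>

type_synonym square = "nat \<times> nat"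

definition board :: "nat \<Rightarrow> square set" where
  "board m = {5, 3, 2, 1} \<times> {0..<m}"

text \<open>A state gives the tokens of each color as a multiset of squares, so the number
  of tokens of color \<open>c\<close> on the square \<open>q\<close> is \<open>count (s c) q\<close>.\<close>

type_synonym state = "color \<Rightarrow> square multiset"

definition is_state :: "nat \<Rightarrow> state \<Rightarrow> bool" where
  "is_state m s \<longleftrightarrow> (\<forall>c. set_mset (s c) \<subseteq> board m)"

definition empty_state :: state where
  "empty_state = (\<lambda>c. {#})"

text \<open>Only meaningful for digits \<open>d \<le> 9\<close>.\<close>

definition digit_weights :: "nat \<Rightarrow> nat set" where
  "digit_weights d =
    [{}, {1}, {2}, {3}, {3, 1}, {5}, {5, 1}, {5, 2}, {5, 3}, {5, 3, 1}] ! d"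

definition decimal_digit :: "nat \<Rightarrow> nat \<Rightarrow> nat" where
  "decimal_digit a r = a div 10 ^ r mod 10"

definition load :: "nat \<Rightarrow> color \<Rightarrow> nat \<Rightarrow> state \<Rightarrow> state" where
  "load m c a s = s(c := s c +
     (\<Sum>r<m. mset_set ((\<lambda>b. (b, r)) ` digit_weights (decimal_digit a r))))"

definition row_represents :: "square multiset \<Rightarrow> nat \<Rightarrow> nat \<Rightarrow> bool" where
  "row_represents N r d \<longleftrightarrow>
     (\<forall>b\<in>{5, 3, 2, 1}. count N (b, r) = (if b \<in> digit_weights d then 1 else 0))"

definition simple_state :: "nat \<Rightarrow> state \<Rightarrow> bool" where
  "simple_state m s \<longleftrightarrow> is_state m s \<and>
     (\<exists>c. (\<forall>c'. c' \<noteq> c \<longrightarrow> s c' = {#}) \<and> (\<forall>r<m. \<exists>d\<le>9. row_represents (s c) r d))"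

definition row_digit :: "square multiset \<Rightarrow> nat \<Rightarrow> nat" where
  "row_digit N r = (THE d. d \<le> 9 \<and> row_represents N r d)"

definition shown_number :: "nat \<Rightarrow> state \<Rightarrow> int" where
  "shown_number m s =
     (if s Negative = {#} then (\<Sum>r<m. int (row_digit (s Positive) r) * 10 ^ r)
      else - (\<Sum>r<m. int (row_digit (s Negative) r) * 10 ^ r))"

abbreviation tok :: "nat \<Rightarrow> nat \<Rightarrow> nat \<Rightarrow> square multiset" where
  "tok k b r \<equiv> replicate_mset k (b, r)"

text \<open>\<open>table_rule X Y\<close>: a movement that removes the tokens \<open>X\<close> and places the tokens \<open>Y\<close>,
  all of one color.\<close>

inductive table_rule :: "square multiset \<Rightarrow> square multiset \<Rightarrow> bool" where
  iskay: "k \<ge> 1 \<Longrightarrow> table_rule (tok (2*k) 2 r) (tok k 1 r + tok k 3 r)"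
| kimsa: "k \<ge> 1 \<Longrightarrow> table_rule (tok (2*k) 3 r) (tok k 1 r + tok k 5 r)"
| pisqa: "k \<ge> 1 \<Longrightarrow> table_rule (tok (2*k) 5 r) (tok k 1 (r+1))"
| kikin2: "k \<ge> 1 \<Longrightarrow> table_rule (tok (2*k) 1 r) (tok k 2 r)"
| kikin3: "k \<ge> 1 \<Longrightarrow> table_rule (tok (3*k) 1 r) (tok k 3 r)"
| kikin5: "k \<ge> 1 \<Longrightarrow> table_rule (tok (5*k) 1 r) (tok k 5 r)"
| pichana3: "k \<ge> 1 \<Longrightarrow> table_rule (tok k 1 r + tok k 2 r) (tok k 3 r)"
| pichana5: "k \<ge> 1 \<Longrightarrow> table_rule (tok k 2 r + tok k 3 r) (tok k 5 r)"

| expand5: "k \<ge> 1 \<Longrightarrow> table_rule (tok k 5 r) (tok k 3 r + tok k 2 r)"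
| expand3: "k \<ge> 1 \<Longrightarrow> table_rule (tok k 3 r) (tok k 2 r + tok k 1 r)"
| expand2: "k \<ge> 1 \<Longrightarrow> table_rule (tok k 2 r) (tok (2*k) 1 r)"
| expand10_5: "k \<ge> 1 \<Longrightarrow> table_rule (tok k 1 (r+1)) (tok (2*k) 5 r)"
| expand10_532: "k \<ge> 1 \<Longrightarrow>
    table_rule (tok k 1 (r+1)) (tok k 5 r + tok k 3 r + tok k 2 r)"
| expand10_32: "k \<ge> 1 \<Longrightarrow>
    table_rule (tok k 1 (r+1)) (tok (2*k) 3 r + tok (2*k) 2 r)"
| expand10_321: "k \<ge> 1 \<Longrightarrow>
    table_rule (tok k 1 (r+1)) (tok k 3 r + tok (2*k) 2 r + tok (3*k) 1 r)"

| chunka: "b \<in> {5, 3, 2, 1} \<Longrightarrow> n \<ge> 1 \<Longrightarrow> table_rule (tok (10^n) b r) (tok 1 b (r+n))"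
| sonqo: "k \<ge> 1 \<Longrightarrow> table_rule (tok (2*k) 2 r + tok (2*k) 3 r) (tok k 1 (r+1))"
| hatun_pichana: "k \<ge> 1 \<Longrightarrow>
    table_rule (tok k 5 r + tok k 3 r + tok k 2 r) (tok k 1 (r+1))"
| pana_chaska: "k \<ge> 1 \<Longrightarrow>
    table_rule (tok (2*k) 3 r + tok k 2 r + tok (2*k) 1 r) (tok k 1 (r+1))"
| huq_iskay_kimsa: "k \<ge> 1 \<Longrightarrow>
    table_rule (tok k 3 r + tok (2*k) 2 r + tok (3*k) 1 r) (tok k 1 (r+1))"
| kusillu: "k \<ge> 1 \<Longrightarrow> table_rule (tok (3*k) 3 r + tok k 1 r) (tok k 1 (r+1))"

inductive table_move :: "nat \<Rightarrow> state \<Rightarrow> state \<Rightarrow> bool" for m :: nat where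
  exchange: "table_rule X Y \<Longrightarrow> set_mset X \<subseteq> board m \<Longrightarrow> set_mset Y \<subseteq> board m \<Longrightarrow>
    X \<subseteq># s c \<Longrightarrow> table_move m s (s(c := s c - X + Y))"
| chinkay: "k \<ge> 1 \<Longrightarrow> q \<in> board m \<Longrightarrow> (\<And>c. replicate_mset k q \<subseteq># s c) \<Longrightarrow>
    table_move m s (\<lambda>c. s c - replicate_mset k q)"

lemma digit_weights_sum:
  assumes "d \<le> 9"
  shows "digit_weights d \<subseteq> {5, 3, 2, 1}" and "\<Sum>(digit_weights d) = d"
proof -
  have "d \<in> {0, 1, 2, 3, 4, 5, 6, 7, 8, 9}"
    using assms by (simp, presburger)
  then have "digit_weights d \<subseteq> {5, 3, 2, 1} \<and> \<Sum>(digit_weights d) = d"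
    by (elim insertE emptyE) (simp_all add: digit_weights_def)
  then show "digit_weights d \<subseteq> {5, 3, 2, 1}" and "\<Sum>(digit_weights d) = d" by auto
qed

text \<open>The definite description in \<open>row_digit\<close> is well defined whenever the row represents
  a digit.\<close>

lemma row_represents_unique:
  assumes "row_represents N r d" "row_represents N r d'" "d \<le> 9" "d' \<le> 9"
  shows "d = d'"
proof -
  have *: "digit_weights e = {b \<in> {5, 3, 2, 1}. count N (b, r) = 1}"
    if e: "row_represents N r e" "e \<le> 9" for e
  proof -
    have "count N (b, r) = (if b \<in> digit_weights e then 1 else 0)" if "b \<in> {5, 3, 2, 1}" for b
      using e(1) that unfolding row_represents_def by blast
    then have "b \<in> digit_weights e \<longleftrightarrow> count N (b, r) = 1" if "b \<in> {5, 3, 2, 1}" for b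
      using that by presburger
    then show ?thesis
      using digit_weights_sum(1)[OF e(2)] by blast
  qed
  have "digit_weights d = digit_weights d'"
    unfolding *[OF assms(1,3)] *[OF assms(2,4)] ..
  then show ?thesis
    using digit_weights_sum(2)[OF assms(3)] digit_weights_sum(2)[OF assms(4)] by argo
qed

end

theory Submission
  imports Defs
begin

text \<open>The signed value of a state, positive minus negative tokens each counted as \<open>b * 10 ^ r\<close>,
  is invariant under every movement; loading a number adds it to the value, and a simple state
  shows its own value.\<close>

definition token_value :: "square multiset \<Rightarrow> nat" where
  "token_value N = (\<Sum>(b, r)\<in>#N. b * 10 ^ r)"

definition state_value :: "state \<Rightarrow> int" where
  "state_value s = int (token_value (s Positive)) - int (token_value (s Negative))"

lemma token_value_empty [simp]: "token_value {#} = 0"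
  by (simp add: token_value_def)

lemma token_value_union [simp]: "token_value (M + N) = token_value M + token_value N"
  by (simp add: token_value_def)

lemma token_value_single [simp]: "token_value {#(b, r)#} = b * 10 ^ r"
  by (simp add: token_value_def)

lemma token_value_replicate [simp]: "token_value (replicate_mset k (b, r)) = k * (b * 10 ^ r)"
  by (induction k) (simp_all add: token_value_def)

text \<open>Multiset difference truncates, so the inclusion is essential: it makes \<open>N\<close>
  the disjoint union of \<open>X\<close> and the rest. The casts avoid truncated subtraction on the
  values.\<close>

lemma token_value_diff:
  assumes "X \<subseteq># N"
  shows "int (token_value (N - X)) = int (token_value N) - int (token_value X)"
proof -
  have "token_value N = token_value (N - X + X)"
    using assms by (simp only: subset_mset.diff_add)
  then show ?thesis by simp
qed

lemma token_value_sum: "token_value (\<Sum>i\<in>I. f i) = (\<Sum>i\<in>I. token_value (f i))"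
  by (induction I rule: infinite_finite_induct) simp_all

text \<open>Each rule is \<open>k\<close> times an identity between weights, such as 2 + 2 = 1 + 3
  or 5 + 3 + 2 = 10, where one row up counts as a factor 10. The rule \<open>chunka\<close> is
  \<open>power_add\<close>.\<close>

lemma table_rule_token_value: "table_rule X Y \<Longrightarrow> token_value X = token_value Y"
  by (induction rule: table_rule.induct) (simp_all add: algebra_simps power_add)

text \<open>An exchange alters one color only and keeps its value. Chinkay lowers both colors by the
  same amount, which cancels in the difference.\<close>

lemma table_move_state_value: "table_move m s t \<Longrightarrow> state_value t = state_value s"
proof (induction rule: table_move.induct)
  case (exchange X Y s c)
  have "int (token_value (s c - X + Y)) = int (token_value (s c))"
    using token_value_diff[OF exchange.hyps(4)] table_rule_token_value[OF exchange.hyps(1)]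
    by simp
  then show ?case
    by (cases c) (simp_all add: state_value_def)
next
  case (chinkay k q s)
  then show ?case
    by (simp add: state_value_def token_value_diff)
qed

lemma table_moves_state_value: "(table_move m)\<^sup>*\<^sup>* s t \<Longrightarrow> state_value t = state_value s"
  by (induction rule: rtranclp_induct) (simp_all add: table_move_state_value)

lemma token_value_digit:
  assumes "d \<le> 9"
  shows "token_value (mset_set ((\<lambda>b. (b, r)) ` digit_weights d)) = d * 10 ^ r"
proof -
  have "token_value (mset_set ((\<lambda>b. (b, r)) ` digit_weights d))
      = (\<Sum>(b, r)\<in>(\<lambda>b. (b, r)) ` digit_weights d. b * 10 ^ r)"
    by (simp add: token_value_def sum_unfold_sum_mset)
  also have "\<dots> = (\<Sum>b\<in>digit_weights d. b * 10 ^ r)"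
    by (subst sum.reindex) (auto simp: inj_on_def)
  also have "\<dots> = d * 10 ^ r"
    using digit_weights_sum(2)[OF assms] by (simp flip: sum_distrib_right)
  finally show ?thesis .
qed

text \<open>Taking the remainder lets the induction run without a bound on \<open>a\<close>; each
  step splits off the leading digit.\<close>

lemma sum_decimal_digits: "(\<Sum>r<m. decimal_digit a r * 10 ^ r) = a mod 10 ^ m"
proof (induction m)
  case (Suc m)
  have "a mod 10 ^ Suc m = 10 ^ m * (a div 10 ^ m mod 10) + a mod 10 ^ m"
    by (metis mod_mult2_eq power_Suc2)
  with Suc show ?case by (simp add: decimal_digit_def)
qed simp

lemma state_value_load_Positive:
  assumes "a < 10 ^ m"
  shows "state_value (load m Positive a s) = state_value s + int a"
proof -
  have "decimal_digit a r \<le> 9" for r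
    unfolding decimal_digit_def using mod_less_divisor[of 10 "a div 10 ^ r"] by linarith
  then show ?thesis
    using assms
    by (simp add: state_value_def load_def token_value_sum token_value_digit sum_decimal_digits)
qed

lemma state_value_fold_load:
  assumes "\<And>i. i \<in> set xs \<Longrightarrow> a i < 10 ^ m"
  shows "state_value (fold (\<lambda>i. load m Positive (a i)) xs s)
    = state_value s + int (\<Sum>i\<leftarrow>xs. a i)"
  using assms by (induction xs arbitrary: s) (simp_all add: state_value_load_Positive)

text \<open>This brings a simple state into the form that loading produces, so that its value can be
  computed digit by digit.\<close>

lemma mset_eq_sum_digits:
  assumes "set_mset N \<subseteq> board m"
    and d: "\<And>r. r < m \<Longrightarrow> d r \<le> 9" "\<And>r. r < m \<Longrightarrow> row_represents N r (d r)"
  shows "N = (\<Sum>r<m. mset_set ((\<lambda>b. (b, r)) ` digit_weights (d r)))"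
proof (rule multiset_eqI, clarify)
  fix b r
  \<comment> \<open>Needed for counting, since \<open>mset_set\<close> of an infinite set is
    empty.\<close>
  have fin: "finite (digit_weights (d r'))" if "r' < m" for r'
    using digit_weights_sum(1)[OF d(1)[OF that]] finite_subset by blast
  \<comment> \<open>Distinct summands occupy distinct rows, so only the summand of row
    \<open>r\<close> can contain \<open>(b, r)\<close>.\<close>
  have "count (\<Sum>r<m. mset_set ((\<lambda>b. (b, r)) ` digit_weights (d r))) (b, r)
      = (\<Sum>r'<m. if r' = r then if b \<in> digit_weights (d r) then 1 else 0 else 0)"
    unfolding count_sum by (rule sum.cong) (auto simp: count_mset_set' fin)
  also have "\<dots> = (if r < m \<and> b \<in> digit_weights (d r) then 1 else 0)"
    by simp
  also have "\<dots> = count N (b, r)"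
  proof (cases "(b, r) \<in> board m")
    case True
    then have "r < m" "b \<in> {5, 3, 2, 1}" by (auto simp: board_def)
    then have "count N (b, r) = (if b \<in> digit_weights (d r) then 1 else 0)"
      using d(2)[of r] unfolding row_represents_def by blast
    with \<open>r < m\<close> show ?thesis by simp
  next
    case False
    then have "count N (b, r) = 0"
      using assms(1) by (meson count_eq_zero_iff subsetD)
    moreover have "\<not> (r < m \<and> b \<in> digit_weights (d r))"
      using False digit_weights_sum(1)[OF d(1)] by (force simp: board_def)
    ultimately show ?thesis by simp
  qed
  finally show "count N (b, r)
      = count (\<Sum>r<m. mset_set ((\<lambda>b. (b, r)) ` digit_weights (d r))) (b, r)" ..
qed

lemma token_value_row_digits:
  assumes "set_mset N \<subseteq> board m" and "\<forall>r<m. \<exists>d\<le>9. row_represents N r d"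
  shows "token_value N = (\<Sum>r<m. row_digit N r * 10 ^ r)"
proof -
  \<comment> \<open>The definite description is legitimate: existence is the second assumption,
    uniqueness is \<open>row_represents_unique\<close>.\<close>
  have *: "row_digit N r \<le> 9 \<and> row_represents N r (row_digit N r)" if r: "r < m" for r
    unfolding row_digit_def
    by (rule theI') (use assms(2) r row_represents_unique in blast)
  have "token_value N
      = token_value (\<Sum>r<m. mset_set ((\<lambda>b. (b, r)) ` digit_weights (row_digit N r)))"
    using mset_eq_sum_digits[OF assms(1), of "row_digit N"] * by simp
  also have "\<dots> = (\<Sum>r<m. row_digit N r * 10 ^ r)"
    using * by (simp add: token_value_sum token_value_digit)
  finally show ?thesis .
qed

text \<open>At most one color contributes to the value, and the test in \<open>shown_number\<close>
  picks the sign with which it does.\<close>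

lemma simple_state_shown_number:
  assumes "simple_state m s"
  shows "shown_number m s = state_value s"
proof -
  obtain c where c: "\<And>c'. c' \<noteq> c \<Longrightarrow> s c' = {#}"
    and rows: "\<forall>r<m. \<exists>d\<le>9. row_represents (s c) r d"
    using assms by (auto simp: simple_state_def)
  have board: "set_mset (s c') \<subseteq> board m" for c'
    using assms by (simp add: simple_state_def is_state_def)
  show ?thesis
  proof (cases "s Negative = {#}")
    case True
    \<comment> \<open>On an empty board the single color \<open>c\<close> may also be \<open>Negative\<close>.\<close>
    then have "s c = s Positive"
      using c by (cases c) auto
    then show ?thesis
      using True token_value_row_digits[OF board, of Positive] rows
      by (simp add: shown_number_def state_value_def)
  next
    case False
    then have "c = Negative" using c[of Negative] by auto
    moreover from this have "s Positive = {#}" using c[of Positive] by simp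
    ultimately show ?thesis
      using False token_value_row_digits[OF board, of Negative] rows
      by (simp add: shown_number_def state_value_def)
  qed
qed

theorem theorem6:
  fixes m p :: nat and a :: "nat \<Rightarrow> nat" and s :: state
  assumes "m \<ge> 1" and "p \<ge> 2"
    and "\<And>i. i \<in> {1..p} \<Longrightarrow> a i \<le> 10 ^ m - 1"
    and "(table_move m)\<^sup>*\<^sup>* (fold (\<lambda>i. load m Positive (a i)) [1..<p+1] empty_state) s"
    and "simple_state m s"
  shows "shown_number m s = int (\<Sum>i = 1..p. a i)"
proof -
  have less: "a i < 10 ^ m" if "i \<in> set [1..<p+1]" for i
  proof -
    have "a i \<le> 10 ^ m - 1" using that by (intro assms(3)) auto
    \<comment> \<open>Positivity turns the bound with truncated subtraction into a strict
      inequality.\<close>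
    moreover have "(0::nat) < 10 ^ m" by simp
    ultimately show ?thesis by linarith
  qed
  have "shown_number m s = state_value (fold (\<lambda>i. load m Positive (a i)) [1..<p+1] empty_state)"
    using simple_state_shown_number[OF assms(5)] table_moves_state_value[OF assms(4)] by simp
  also have "\<dots> = state_value empty_state + int (\<Sum>i\<leftarrow>[1..<p+1]. a i)"
    by (rule state_value_fold_load) (rule less)
  \<comment> \<open>Without \<open>upt_Suc\<close> the list stays a whole interval, as the
    conversion to a set sum requires.\<close>
  also have "(\<Sum>i\<leftarrow>[1..<p+1]. a i) = (\<Sum>i = 1..p. a i)"
    by (simp add: interv_sum_list_conv_sum_set_nat atLeastLessThanSuc_atLeastAtMost
        del: upt_Suc)
  finally show ?thesis
    by (simp add: state_value_def empty_state_def)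
qed

end
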